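(* Let $\Omega$ be a feasible patch, i.e. $\mathcal{C}_u(\Omega)\neq\emptyset$. Then the patch energy $J_\Omega$ is jointly convex in $(u_I,\pi)$ on $\mathcal{C}_u(\Omega)\times\mathcal{C}_\pi(\Omega)$.
   Context: Grid and patch. $\mathcal{G}=\{1,\dots,n_m\}\times\{1,\dots,n_\tau\}$, $G=n_mn_\tau$; nodal surfaces are $u\in\mathbb{R}^G$; $u^0\in\mathbb{R}^G$ is a fixed baseline; $F_{i,j}\in\mathbb{R}$ are fixed forwards. A patch is a nonempty $\Omega\subset\mathcal{G}$, $N_\Omega=|\Omega|$. For $u_I\in\mathbb{R}^{N_\Omega}$ (indexed by $\Omega$) the assembled surface $u(u_I)\in\mathbb{R}^G$ equals $u_I$ on $\Omega$ and $u^0$ off $\Omega$, i.e. $u(u_I)=P_\Omega u_I+u^{0,\mathrm{off}}$ with $P_\Omega\in\mathbb{R}^{G\times N_\Omega}$ the injection and $u^{0,\mathrm{off}}$ equal to $u^0$ off $\Omega$ and $0$ on $\Omega$. $u_I^0$ is the restriction of $u^0$ to $\Omega$. No-arbitrage set. $\mathcal{C}_{\mathrm{glob}}\subset\mathbb{R}^G$ is the set of $u$ with $0\le u_{i,j}\le F_{i,j}$ for all $(i,j)$; $u_{i+1,j}-u_{i,j}\le0$ ($1\le i\le n_m-1$); $u_{i+1,j}-2u_{i,j}+u_{i-1,j}\ge0$ ($2\le i\le n_m-1$); and $(A_{\tau|K}u)_g\ge0$ for all $g$, with $A_{\tau|K}\in\mathbb{R}^{G\times G}$ a fixed matrix. $\mathcal{C}_u(\Omega)=\{u_I\in\mathbb{R}^{N_\Omega}:u(u_I)\in\mathcal{C}_{\mathrm{glob}}\}$.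 Fog. Fix price levels $u_1<\dots<u_{n_u}$ in $\mathbb{R}$; $\mathcal{L}_\Omega=\{(i,j,k):(i,j)\in\Omega,1\le k\le n_u\}$, $N_L=N_\Omega n_u$; $\mathcal{C}_\pi(\Omega)=\{\pi\in\mathbb{R}^{N_L}:\pi_{i,j,k}\ge0,\ \sum\pi_{i,j,k}=1\}$. Quotes. Each quote $q\in\{1,\dots,Q\}$ has a band $[b_q,a_q]$, $0\le b_q\le a_q$; $S\in\mathbb{R}^{Q\times G}$ is a fixed interpolation matrix; $d_q(u)=\max\{b_q-(Su)_q,0,(Su)_q-a_q\}$. $Q_\Omega$ is the set of $q$ whose row of $S$ has a nonzero entry at some node of $\Omega$; each such $q$ has a fixed representative node $(i_q,j_q)\in\Omega$. $M_q(\pi)=\sum_{k:\,u_k<b_q\text{ or }u_k>a_q}\pi_{i_q,j_q,k}$. With fixed $\varepsilon>0$ and $\lambda_{\mathrm{noise}}\ge0$, $$\phi_q(u_I,\pi)=\frac{d_q(u(u_I))^2}{\varepsilon+M_q(\pi)}+\lambda_{\mathrm{noise}}(\varepsilon+M_q(\pi)).$$ Surface terms. $E_{\mathrm{cl}}(u_I)=\frac{\lambda_{\mathrm{cl}}}{2}\|u_I-u_I^0\|_2^2$ with $\lambda_{\mathrm{cl}}>0$. $D_\rho\in\mathbb{R}^{N_\rho\times G}$ is a fixed density matrix; $R_\Omega$ extracts the rows $r$ with $(D_\rho P_\Omega)_{r,\cdot}\ne0$; $\rho_\Omega(u_I)=R_\Omega D_\rho u(u_I)$; $E_{\mathrm{surf}}(u_I)=\frac12\rho_\Omega(u_I)^\top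 H_\rho\rho_\Omega(u_I)$ with $H_\rho$ symmetric positive semidefinite. Hamiltonian. $E_m,E_\tau,E_u$ are the sets of nearest-neighbour edges of $\mathcal{L}_\Omega$ in the $i$-, $j$-, $k$-direction (both endpoints in $\mathcal{L}_\Omega$); $D_m,D_\tau,D_u$ are the corresponding signed incidence (forward difference) matrices acting on $\mathbb{R}^{N_L}$; $W_m,W_\tau,W_u$ are diagonal nonnegative edge-weight matrices; $\kappa_m,\kappa_\tau,\kappa_u\ge0$; $L_\pi=\kappa_mD_m^\top W_mD_m+\kappa_\tau D_\tau^\top W_\tau D_\tau+\kappa_uD_u^\top W_uD_u$. The potential is $V_{i,j,k}=V^{\mathrm{band}}_{i,j,k}+V^{\mathrm{range}}_{i,j,k}\ge0$, with $V^{\mathrm{band}}_{i,j,k}=\alpha_{\mathrm{band}}\mathrm{dist}(u_k,[b_q,a_q])^2$ if $(i,j)=(i_q,j_q)$ for some quote $q$ on the patch (one such $q$ being fixed per node) and $0$ otherwise, $V^{\mathrm{range}}_{i,j,k}=\alpha_{\mathrm{range}}(\mathbf 1_{u_k<0}+\mathbf 1_{u_k>F_{i,j}})$, $\alpha_{\mathrm{band}},\alpha_{\mathrm{range}}\ge0$. $H_\pi=L_\pi+\mathrm{diag}(V)$ and $\mathcal{E}_{\mathrm{Ham}}(\pi)=\frac12\pi^\top H_\pi\pi$. Patch energy. With $\lambda_{\mathrm{surf}},\lambda_\pi\ge0$, $J_\Omega:\mathcal{C}_u(\Omega)\times\mathcal{C}_\pi(\Omega)\to\mathbb{R}$ is $$J_\Omega(u_I,\pi)=\sum_{q\in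 Q_\Omega}\phi_q(u_I,\pi)+E_{\mathrm{cl}}(u_I)+\lambda_{\mathrm{surf}}E_{\mathrm{surf}}(u_I)+\lambda_\pi\mathcal{E}_{\mathrm{Ham}}(\pi).$$ *)

theory Defs
  imports "HOL-Analysis.Analysis" "HOL-Library.Function_Algebras"
begin

section \<open>Vectors indexed by an explicit finite set\<close>

text \<open>
  The spaces \<open>\<real>\<^sup>G\<close>, \<open>\<real>\<^sup>N\<close> of the model are indexed by varying finite sets of nodes. A vector indexed
  by a set \<open>A\<close> is a real function that vanishes outside \<open>A\<close>. Functions form a real vector space
  pointwise, so that the library notions \<open>convex\<close> and \<open>convex_on\<close> apply.
\<close>

instantiation "fun" :: (type, scaleR) scaleR
begin

definition scaleR_fun_def: "scaleR c f = (\<lambda>x. c *\<^sub>R f x)"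

instance ..

end

instance "fun" :: (type, real_vector) real_vector
  by standard (simp_all add: scaleR_fun_def plus_fun_def fun_eq_iff scaleR_add_right scaleR_add_left)

definition vectors_on :: "'a set \<Rightarrow> ('a \<Rightarrow> real) set" where
  "vectors_on A = {x. \<forall>a. a \<notin> A \<longrightarrow> x a = 0}"

text \<open>Matrices are functions of a row and a column index; only the entries whose indices lie in the
  relevant finite index sets are ever used.\<close>

definition mat_vec :: "'b set \<Rightarrow> ('a \<Rightarrow> 'b \<Rightarrow> real) \<Rightarrow> ('b \<Rightarrow> real) \<Rightarrow> 'a \<Rightarrow> real" where
  "mat_vec B A x r = (\<Sum>c\<in>B. A r c * x c)"

definition quad_form :: "'a set \<Rightarrow> ('a \<Rightarrow> 'a \<Rightarrow> real) \<Rightarrow> ('a \<Rightarrow> real) \<Rightarrow> real" where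
  "quad_form A H x = (\<Sum>r\<in>A. \<Sum>c\<in>A. x r * H r c * x c)"

definition sym_psd_on :: "'a set \<Rightarrow> ('a \<Rightarrow> 'a \<Rightarrow> real) \<Rightarrow> bool" where
  "sym_psd_on A H \<longleftrightarrow> (\<forall>r\<in>A. \<forall>c\<in>A. H r c = H c r) \<and> (\<forall>x. 0 \<le> quad_form A H x)"


section \<open>Model data\<close>

type_synonym node = "nat \<times> nat"
type_synonym site = "nat \<times> nat \<times> nat"

text \<open>Data that do not depend on the patch: \<open>calendar\<close> is $A_{\tau|K}$, \<open>interp\<close> is $S$,
  \<open>density\<close> is $D_\rho$.\<close>

record fog_model =
  n_m :: nat
  n_tau :: nat
  baseline :: "node \<Rightarrow> real"
  forward :: "node \<Rightarrow> real"
  calendar :: "node \<Rightarrow> node \<Rightarrow> real"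
  n_u :: nat
  level :: "nat \<Rightarrow> real"
  n_quotes :: nat
  bid :: "nat \<Rightarrow> real"
  ask :: "nat \<Rightarrow> real"
  interp :: "nat \<Rightarrow> node \<Rightarrow> real"
  n_rho :: nat
  density :: "nat \<Rightarrow> node \<Rightarrow> real"
  epsilon :: real
  lambda_noise :: real
  lambda_cl :: real
  lambda_surf :: real
  lambda_pi :: real
  kappa_m :: real
  kappa_tau :: real
  kappa_u :: real
  alpha_band :: real
  alpha_range :: real

text \<open>Data attached to a patch: \<open>rep q\<close> is the representative node $(i_q,j_q)$; \<open>band_quote p\<close> is the
  quote selected at a node \<open>p\<close> that represents at least one quote; the \<open>weight\<close> fields are the
  diagonals of $W_m, W_\tau, W_u$.\<close>

record fog_patch =
  nodes :: "node set"
  rep :: "nat \<Rightarrow> node"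
  band_quote :: "node \<Rightarrow> nat"
  H_rho :: "nat \<Rightarrow> nat \<Rightarrow> real"
  weight_m :: "site \<times> site \<Rightarrow> real"
  weight_tau :: "site \<times> site \<Rightarrow> real"
  weight_u :: "site \<times> site \<Rightarrow> real"


section \<open>Surfaces and no-arbitrage sets\<close>

definition grid :: "fog_model \<Rightarrow> node set" where
  "grid M = {1..n_m M} \<times> {1..n_tau M}"

definition assembled :: "fog_model \<Rightarrow> node set \<Rightarrow> (node \<Rightarrow> real) \<Rightarrow> node \<Rightarrow> real" where
  "assembled M \<Omega> u\<^sub>I = (\<lambda>p. if p \<in> \<Omega> then u\<^sub>I p else baseline M p)"

definition injection :: "node set \<Rightarrow> node \<Rightarrow> node \<Rightarrow> real" where
  "injection \<Omega> g p = (if p \<in> \<Omega> \<and> g = p then 1 else 0)"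

lemma assembled_eq_injection:
  assumes "finite \<Omega>"
  shows "assembled M \<Omega> u\<^sub>I g =
    mat_vec \<Omega> (injection \<Omega>) u\<^sub>I g + (if g \<in> \<Omega> then 0 else baseline M g)"
proof -
  have "mat_vec \<Omega> (injection \<Omega>) u\<^sub>I g = (\<Sum>p\<in>\<Omega>. if g = p then u\<^sub>I p else 0)"
    unfolding mat_vec_def injection_def by (intro sum.cong) auto
  then show ?thesis
    using assms by (simp add: assembled_def)
qed

definition restricted_baseline :: "fog_model \<Rightarrow> node set \<Rightarrow> node \<Rightarrow> real" where
  "restricted_baseline M \<Omega> = (\<lambda>p. if p \<in> \<Omega> then baseline M p else 0)"

definition C_glob :: "fog_model \<Rightarrow> (node \<Rightarrow> real) set" where
  "C_glob M = {u \<in> vectors_on (grid M).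
     (\<forall>p\<in>grid M. 0 \<le> u p \<and> u p \<le> forward M p) \<and>
     (\<forall>i\<in>{1..<n_m M}. \<forall>j\<in>{1..n_tau M}. u (i + 1, j) - u (i, j) \<le> 0) \<and>
     (\<forall>i\<in>{2..<n_m M}. \<forall>j\<in>{1..n_tau M}. u (i + 1, j) - 2 * u (i, j) + u (i - 1, j) \<ge> 0) \<and>
     (\<forall>g\<in>grid M. mat_vec (grid M) (calendar M) u g \<ge> 0)}"

definition C_u :: "fog_model \<Rightarrow> node set \<Rightarrow> (node \<Rightarrow> real) set" where
  "C_u M \<Omega> = {u\<^sub>I \<in> vectors_on \<Omega>. assembled M \<Omega> u\<^sub>I \<in> C_glob M}"

definition feasible :: "fog_model \<Rightarrow> node set \<Rightarrow> bool" where
  "feasible M \<Omega> \<longleftrightarrow> C_u M \<Omega> \<noteq> {}"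


section \<open>Fog\<close>

definition lattice :: "fog_model \<Rightarrow> node set \<Rightarrow> site set" where
  "lattice M \<Omega> = {(i, j, k). (i, j) \<in> \<Omega> \<and> k \<in> {1..n_u M}}"

definition C_pi :: "fog_model \<Rightarrow> node set \<Rightarrow> (site \<Rightarrow> real) set" where
  "C_pi M \<Omega> = {\<pi> \<in> vectors_on (lattice M \<Omega>).
     (\<forall>l\<in>lattice M \<Omega>. 0 \<le> \<pi> l) \<and> (\<Sum>l\<in>lattice M \<Omega>. \<pi> l) = 1}"


section \<open>Quotes\<close>

definition quote_violation :: "fog_model \<Rightarrow> nat \<Rightarrow> (node \<Rightarrow> real) \<Rightarrow> real" where
  "quote_violation M q u =
     (let s = mat_vec (grid M) (interp M) u q in max (bid M q - s) (max 0 (s - ask M q)))"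

definition patch_quotes :: "fog_model \<Rightarrow> node set \<Rightarrow> nat set" where
  "patch_quotes M \<Omega> = {q \<in> {1..n_quotes M}. \<exists>p\<in>\<Omega>. interp M q p \<noteq> 0}"

definition outside_mass :: "fog_model \<Rightarrow> fog_patch \<Rightarrow> nat \<Rightarrow> (site \<Rightarrow> real) \<Rightarrow> real" where
  "outside_mass M P q \<pi> =
     (\<Sum>k | k \<in> {1..n_u M} \<and> (level M k < bid M q \<or> level M k > ask M q).
        \<pi> (fst (rep P q), snd (rep P q), k))"

definition quote_energy ::
    "fog_model \<Rightarrow> fog_patch \<Rightarrow> nat \<Rightarrow> (node \<Rightarrow> real) \<Rightarrow> (site \<Rightarrow> real) \<Rightarrow> real" where
  "quote_energy M P q u\<^sub>I \<pi> =
     (quote_violation M q (assembled M (nodes P) u\<^sub>I))\<^sup>2 / (epsilon M + outside_mass M P q \<pi>)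
     + lambda_noise M * (epsilon M + outside_mass M P q \<pi>)"


section \<open>Surface terms\<close>

definition closeness_energy :: "fog_model \<Rightarrow> node set \<Rightarrow> (node \<Rightarrow> real) \<Rightarrow> real" where
  "closeness_energy M \<Omega> u\<^sub>I =
     lambda_cl M / 2 * (L2_set (\<lambda>p. u\<^sub>I p - restricted_baseline M \<Omega> p) \<Omega>)\<^sup>2"

text \<open>The row extraction $R_\Omega$ is represented by keeping the original row indices: the
  vector $\rho_\Omega$ and the matrix $H_\rho$ are indexed by \<open>density_rows\<close>.\<close>

definition density_rows :: "fog_model \<Rightarrow> node set \<Rightarrow> nat set" where
  "density_rows M \<Omega> = {r \<in> {1..n_rho M}.
     \<exists>p\<in>\<Omega>. (\<Sum>g\<in>grid M. density M r g * injection \<Omega> g p) \<noteq> 0}"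

definition patch_density :: "fog_model \<Rightarrow> node set \<Rightarrow> (node \<Rightarrow> real) \<Rightarrow> nat \<Rightarrow> real" where
  "patch_density M \<Omega> u\<^sub>I = mat_vec (grid M) (density M) (assembled M \<Omega> u\<^sub>I)"

definition surface_energy :: "fog_model \<Rightarrow> fog_patch \<Rightarrow> (node \<Rightarrow> real) \<Rightarrow> real" where
  "surface_energy M P u\<^sub>I =
     1 / 2 * quad_form (density_rows M (nodes P)) (H_rho P) (patch_density M (nodes P) u\<^sub>I)"


section \<open>Hamiltonian\<close>

text \<open>An edge is oriented towards the endpoint with the larger coordinate.\<close>

definition edges_m :: "fog_model \<Rightarrow> node set \<Rightarrow> (site \<times> site) set" where
  "edges_m M \<Omega> = {((i, j, k), (i + 1, j, k)) | i j k.
     (i, j, k) \<in> lattice M \<Omega> \<and> (i + 1, j, k) \<in> lattice M \<Omega>}"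

definition edges_tau :: "fog_model \<Rightarrow> node set \<Rightarrow> (site \<times> site) set" where
  "edges_tau M \<Omega> = {((i, j, k), (i, j + 1, k)) | i j k.
     (i, j, k) \<in> lattice M \<Omega> \<and> (i, j + 1, k) \<in> lattice M \<Omega>}"

definition edges_u :: "fog_model \<Rightarrow> node set \<Rightarrow> (site \<times> site) set" where
  "edges_u M \<Omega> = {((i, j, k), (i, j, k + 1)) | i j k.
     (i, j, k) \<in> lattice M \<Omega> \<and> (i, j, k + 1) \<in> lattice M \<Omega>}"

definition incidence :: "site \<times> site \<Rightarrow> site \<Rightarrow> real" where
  "incidence e l = (if l = snd e then 1 else if l = fst e then - 1 else 0)"

text \<open>The entries of $D^\top W D$ for the incidence matrix $D$ of an edge set and a diagonal
  weight matrix $W$.\<close>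

definition weighted_laplacian ::
    "(site \<times> site) set \<Rightarrow> (site \<times> site \<Rightarrow> real) \<Rightarrow> site \<Rightarrow> site \<Rightarrow> real" where
  "weighted_laplacian E w l l' = (\<Sum>e\<in>E. incidence e l * w e * incidence e l')"

definition L_pi :: "fog_model \<Rightarrow> fog_patch \<Rightarrow> site \<Rightarrow> site \<Rightarrow> real" where
  "L_pi M P l l' =
     kappa_m M * weighted_laplacian (edges_m M (nodes P)) (weight_m P) l l'
     + kappa_tau M * weighted_laplacian (edges_tau M (nodes P)) (weight_tau P) l l'
     + kappa_u M * weighted_laplacian (edges_u M (nodes P)) (weight_u P) l l'"

definition V_band :: "fog_model \<Rightarrow> fog_patch \<Rightarrow> site \<Rightarrow> real" where
  "V_band M P = (\<lambda>(i, j, k).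
     if \<exists>q\<in>patch_quotes M (nodes P). rep P q = (i, j)
     then let q = band_quote P (i, j)
          in alpha_band M * (infdist (level M k) {bid M q..ask M q})\<^sup>2
     else 0)"

definition V_range :: "fog_model \<Rightarrow> site \<Rightarrow> real" where
  "V_range M = (\<lambda>(i, j, k).
     alpha_range M * (of_bool (level M k < 0) + of_bool (level M k > forward M (i, j))))"

definition potential :: "fog_model \<Rightarrow> fog_patch \<Rightarrow> site \<Rightarrow> real" where
  "potential M P l = V_band M P l + V_range M l"

lemma potential_nonneg:
  assumes "alpha_band M \<ge> 0" "alpha_range M \<ge> 0"
  shows "potential M P l \<ge> 0"
  using assms by (cases l) (simp add: potential_def V_band_def V_range_def Let_def)

definition H_pi :: "fog_model \<Rightarrow> fog_patch \<Rightarrow> site \<Rightarrow> site \<Rightarrow> real" where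
  "H_pi M P l l' = L_pi M P l l' + (if l = l' then potential M P l else 0)"

definition hamiltonian_energy :: "fog_model \<Rightarrow> fog_patch \<Rightarrow> (site \<Rightarrow> real) \<Rightarrow> real" where
  "hamiltonian_energy M P \<pi> = 1 / 2 * quad_form (lattice M (nodes P)) (H_pi M P) \<pi>"


section \<open>Patch energy\<close>

definition patch_energy ::
    "fog_model \<Rightarrow> fog_patch \<Rightarrow> (node \<Rightarrow> real) \<Rightarrow> (site \<Rightarrow> real) \<Rightarrow> real" where
  "patch_energy M P u\<^sub>I \<pi> =
     (\<Sum>q\<in>patch_quotes M (nodes P). quote_energy M P q u\<^sub>I \<pi>)
     + closeness_energy M (nodes P) u\<^sub>I
     + lambda_surf M * surface_energy M P u\<^sub>I
     + lambda_pi M * hamiltonian_energy M P \<pi>"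


section \<open>Standing assumptions\<close>

definition valid_model :: "fog_model \<Rightarrow> bool" where
  "valid_model M \<longleftrightarrow>
     baseline M \<in> vectors_on (grid M) \<and>
     n_u M \<ge> 1 \<and> strict_mono_on {1..n_u M} (level M) \<and>
     (\<forall>q\<in>{1..n_quotes M}. 0 \<le> bid M q \<and> bid M q \<le> ask M q) \<and>
     epsilon M > 0 \<and> lambda_noise M \<ge> 0 \<and> lambda_cl M > 0 \<and>
     lambda_surf M \<ge> 0 \<and> lambda_pi M \<ge> 0 \<and>
     kappa_m M \<ge> 0 \<and> kappa_tau M \<ge> 0 \<and> kappa_u M \<ge> 0 \<and>
     alpha_band M \<ge> 0 \<and> alpha_range M \<ge> 0"

definition valid_patch :: "fog_model \<Rightarrow> fog_patch \<Rightarrow> bool" where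
  "valid_patch M P \<longleftrightarrow>
     nodes P \<noteq> {} \<and> nodes P \<subseteq> grid M \<and>
     (\<forall>q\<in>patch_quotes M (nodes P). rep P q \<in> nodes P) \<and>
     (\<forall>q\<in>patch_quotes M (nodes P).
        band_quote P (rep P q) \<in> patch_quotes M (nodes P) \<and>
        rep P (band_quote P (rep P q)) = rep P q) \<and>
     sym_psd_on (density_rows M (nodes P)) (H_rho P) \<and>
     (\<forall>e\<in>edges_m M (nodes P). weight_m P e \<ge> 0) \<and>
     (\<forall>e\<in>edges_tau M (nodes P). weight_tau P e \<ge> 0) \<and>
     (\<forall>e\<in>edges_u M (nodes P). weight_u P e \<ge> 0)"

end

theory Submission
  imports Defs
begin

text \<open>
  Every term of the energy is a convex function composed with an affine map. Only the quote terms
  are coupled in $(u_I,\pi)$; they are handled by the perspective inequality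
  $(a d_1 + b d_2)^2 / (a t_1 + b t_2) \le a\, d_1^2 / t_1 + b\, d_2^2 / t_2$, because the violation
  is a convex nonnegative function of the surface and the denominator is affine and positive in
  the fog. The quadratic terms have positive semidefinite matrices: the weighted Laplacian has the
  form $\sum_e w_e (D x)_e^2$.
\<close>

section \<open>Affine maps and convexity\<close>

text \<open>Preservation of two-point combinations with weights of any sign. No linear part or
  constant term has to be split off, and the condition has exactly the shape in which
  \<open>convex_on\<close> uses it.\<close>

definition affine_map :: "('a::real_vector \<Rightarrow> 'b::real_vector) \<Rightarrow> bool" where
  "affine_map f \<longleftrightarrow>
     (\<forall>x y a b. a + b = 1 \<longrightarrow> f (a *\<^sub>R x + b *\<^sub>R y) = a *\<^sub>R f x + b *\<^sub>R f y)"

lemma affine_mapD: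
  "affine_map f \<Longrightarrow> a + b = 1 \<Longrightarrow> f (a *\<^sub>R x + b *\<^sub>R y) = a *\<^sub>R f x + b *\<^sub>R f y"
  by (simp add: affine_map_def)

lemma affine_map_compose:
  "affine_map f \<Longrightarrow> affine_map g \<Longrightarrow> affine_map (\<lambda>x. f (g x))"
  by (simp add: affine_map_def)

lemma affine_map_linear: "linear f \<Longrightarrow> affine_map f"
  by (simp add: affine_map_def linear_add linear_scale)

lemma affine_map_diff_const:
  "affine_map f \<Longrightarrow> affine_map (\<lambda>x. f x - c)"
  unfolding affine_map_def
proof (intro allI impI)
  fix x y and a b :: real
  assume f: "\<forall>x y a b. a + b = 1 \<longrightarrow> f (a *\<^sub>R x + b *\<^sub>R y) = a *\<^sub>R f x + b *\<^sub>R f y"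
    and ab: "a + b = 1"
  have "a *\<^sub>R c + b *\<^sub>R c = c"
    using ab by (simp flip: scaleR_left_distrib)
  moreover have "a *\<^sub>R (f x - c) + b *\<^sub>R (f y - c)
      = (a *\<^sub>R f x + b *\<^sub>R f y) - (a *\<^sub>R c + b *\<^sub>R c)"
    by (simp add: scaleR_diff_right)
  ultimately show "f (a *\<^sub>R x + b *\<^sub>R y) - c = a *\<^sub>R (f x - c) + b *\<^sub>R (f y - c)"
    using f ab by simp
qed

lemma affine_map_const_add:
  "affine_map f \<Longrightarrow> affine_map (\<lambda>x. c + f x)"
  using affine_map_diff_const[of f "- c"] by (simp add: add.commute)

lemma affine_map_const_diff:
  assumes "affine_map f"
  shows "affine_map (\<lambda>x. c - f x)"
proof -
  have "affine_map (\<lambda>x. - f x)"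
    using assms by (simp add: affine_map_def)
  then show ?thesis
    using affine_map_const_add[of "\<lambda>x. - f x" c] by simp
qed

text \<open>Makes coordinates linear functionals, so that pointwise constraints and matrix rows fit
  the general lemmas.\<close>

lemma linear_apply: "linear (\<lambda>f :: 'a \<Rightarrow> 'b::real_vector. f x)"
  by (intro linearI) (simp_all add: scaleR_fun_def)

lemma convex_affine_vimage: "affine_map f \<Longrightarrow> convex T \<Longrightarrow> convex (f -` T)"
  by (simp add: convex_def affine_mapD)

lemma convex_on_affine_compose:
  assumes "convex_on T f" "affine_map g" "convex S" "g ` S \<subseteq> T"
  shows "convex_on S (\<lambda>x. f (g x))"
  using assms by (auto simp: convex_on_def affine_mapD image_subset_iff)

lemma convex_on_affine:
  fixes g :: "'a::real_vector \<Rightarrow> real"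
  assumes "affine_map g" "convex S"
  shows "convex_on S g"
  using assms by (auto simp: convex_on_def affine_mapD)

text \<open>Each of the two functions lies below the same combination of maxima, hence so does the
  larger one.\<close>

lemma convex_on_max:
  assumes "convex_on S f" "convex_on S g"
  shows "convex_on S (\<lambda>x. max (f x) (g x))"
  unfolding convex_on_def
proof (intro conjI ballI allI impI)
  show "convex S"
    using assms(1) by (rule convex_on_imp_convex)
  fix x y and a b :: real
  assume *: "x \<in> S" "y \<in> S" "0 \<le> a" "0 \<le> b" "a + b = 1"
  have "f (a *\<^sub>R x + b *\<^sub>R y) \<le> a * f x + b * f y"
    using assms * by (simp add: convex_on_def)
  also have "\<dots> \<le> a * max (f x) (g x) + b * max (f y) (g y)"
    using * by (intro add_mono mult_left_mono) auto
  finally have f: "f (a *\<^sub>R x + b *\<^sub>R y) \<le> a * max (f x) (g x) + b * max (f y) (g y)" .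
  have "g (a *\<^sub>R x + b *\<^sub>R y) \<le> a * g x + b * g y"
    using assms * by (simp add: convex_on_def)
  also have "\<dots> \<le> a * max (f x) (g x) + b * max (f y) (g y)"
    using * by (intro add_mono mult_left_mono) auto
  finally show "max (f (a *\<^sub>R x + b *\<^sub>R y)) (g (a *\<^sub>R x + b *\<^sub>R y))
      \<le> a * max (f x) (g x) + b * max (f y) (g y)"
    using f by simp
qed

text \<open>For an empty or infinite \<open>I\<close> the sum is the zero function, whose convexity
  on \<open>S\<close> amounts to \<open>convex S\<close>.\<close>

lemma convex_on_sum_fun:
  assumes "convex S" "\<And>i. i \<in> I \<Longrightarrow> convex_on S (f i)"
  shows "convex_on S (\<lambda>x. \<Sum>i\<in>I. f i x)"
  using assms(2)
  by (induction I rule: infinite_finite_induct)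
    (auto intro!: convex_on_add simp: convex_on_const assms(1))

text \<open>Joint convexity of the perspective of the square, a two-term Cauchy-Schwarz
  inequality.\<close>

lemma perspective_inequality:
  fixes a b d e s t :: real
  assumes "0 \<le> a" "0 \<le> b" "a + b = 1" "0 < s" "0 < t"
  shows "(a * d + b * e)\<^sup>2 / (a * s + b * t) \<le> a * (d\<^sup>2 / s) + b * (e\<^sup>2 / t)"
proof -
  \<comment> \<open>In terms of the ratios \<open>p\<close> and \<open>r\<close> both sides lose
    their inner divisions, and only the common denominator remains to be cleared.\<close>
  define p where "p = d / s"
  define r where "r = e / t"
  have de: "d = p * s" "e = r * t"
    using assms by (simp_all add: p_def r_def)
  \<comment> \<open>One weight may vanish, but then the other equals 1.\<close>
  have pos: "0 < a * s + b * t"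
    using assms by (cases "a = 0") (auto intro: add_pos_nonneg)
  \<comment> \<open>The gap in the inequality, after clearing the denominator, is an explicit
    multiple of a square.\<close>
  have "(a * p\<^sup>2 * s + b * r\<^sup>2 * t) * (a * s + b * t) - (a * (p * s) + b * (r * t))\<^sup>2
      = a * b * s * t * (p - r)\<^sup>2"
    by (simp add: power2_eq_square algebra_simps)
  moreover have "0 \<le> a * b * s * t * (p - r)\<^sup>2"
    using assms by simp
  ultimately have "(a * (p * s) + b * (r * t))\<^sup>2 / (a * s + b * t) \<le> a * p\<^sup>2 * s + b * r\<^sup>2 * t"
    using pos by (simp add: pos_divide_le_eq)
  also have "\<dots> = a * ((p * s)\<^sup>2 / s) + b * ((r * t)\<^sup>2 / t)"
    using assms by (simp add: power2_eq_square)
  finally show ?thesis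
    unfolding de .
qed

lemma convex_on_square_over_affine:
  assumes "convex_on S d" "\<And>x. x \<in> S \<Longrightarrow> 0 \<le> d x"
    and "affine_map t" "\<And>x. x \<in> S \<Longrightarrow> 0 < t x"
  shows "convex_on S (\<lambda>x. (d x)\<^sup>2 / t x)"
  unfolding convex_on_def
proof (intro conjI ballI allI impI)
  show S: "convex S"
    using assms(1) by (rule convex_on_imp_convex)
  fix x y and a b :: real
  assume *: "x \<in> S" "y \<in> S" "0 \<le> a" "0 \<le> b" "a + b = 1"
  let ?z = "a *\<^sub>R x + b *\<^sub>R y"
  have z: "?z \<in> S"
    using S * by (simp add: convex_def)
  have "d ?z \<le> a * d x + b * d y"
    using assms(1) * by (simp add: convex_on_def)
  \<comment> \<open>Squaring preserves the convexity bound because \<open>d ?z\<close> is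
    nonnegative.\<close>
  then have "(d ?z)\<^sup>2 / t ?z \<le> (a * d x + b * d y)\<^sup>2 / t ?z"
    using assms(2,4)[OF z] by (intro divide_right_mono power_mono) auto
  also have "\<dots> = (a * d x + b * d y)\<^sup>2 / (a * t x + b * t y)"
    using assms(3) * by (simp add: affine_mapD)
  also have "\<dots> \<le> a * ((d x)\<^sup>2 / t x) + b * ((d y)\<^sup>2 / t y)"
    using * assms(4) by (intro perspective_inequality) auto
  finally show "(d ?z)\<^sup>2 / t ?z \<le> a * ((d x)\<^sup>2 / t x) + b * ((d y)\<^sup>2 / t y)" .
qed

section \<open>Quadratic forms\<close>

lemma linear_mat_vec: "linear (mat_vec B A)"
  by (intro linearI)
    (auto simp: mat_vec_def fun_eq_iff scaleR_fun_def algebra_simps sum.distrib sum_distrib_left)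

text \<open>Holds entry by entry, from a^2 = a - a b and b^2 = b - a b. The last term is the
  convexity gap, so a nonnegative form is convex.\<close>

lemma quad_form_combination:
  assumes "a + b = 1"
  shows "quad_form A H (a *\<^sub>R x + b *\<^sub>R y)
    = a * quad_form A H x + b * quad_form A H y - a * b * quad_form A H (x - y)"
proof -
  have b: "b = 1 - a"
    using assms by simp
  show ?thesis
    unfolding quad_form_def sum_distrib_left sum_subtractf[symmetric] sum.distrib[symmetric]
    by (intro sum.cong refl) (simp add: b scaleR_fun_def algebra_simps)
qed

lemma convex_on_quad_form:
  assumes "\<And>x. 0 \<le> quad_form A H x"
  shows "convex_on UNIV (quad_form A H)"
  using assms by (auto simp: convex_on_def quad_form_combination)

lemma quad_form_add:
  "quad_form A (\<lambda>r c. H r c + K r c) x = quad_form A H x + quad_form A K x"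
  by (simp add: quad_form_def algebra_simps sum.distrib)

lemma quad_form_cmul: "quad_form A (\<lambda>r c. k * H r c) x = k * quad_form A H x"
  by (simp add: quad_form_def sum_distrib_left algebra_simps)

lemma quad_form_diagonal:
  assumes "finite A"
  shows "quad_form A (\<lambda>r c. if r = c then v r else 0) x = (\<Sum>r\<in>A. v r * (x r)\<^sup>2)"
proof -
  have "quad_form A (\<lambda>r c. if r = c then v r else 0) x
      = (\<Sum>r\<in>A. \<Sum>c\<in>A. if r = c then v r * (x r)\<^sup>2 else 0)"
    unfolding quad_form_def by (intro sum.cong refl) (simp add: power2_eq_square)
  then show ?thesis
    using assms by simp
qed

text \<open>The inner sum is the component of D x at the edge \<open>e\<close>. Once the edge sum is
  moved outermost, the double sum over sites factors into a square.\<close>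

lemma quad_form_weighted_laplacian:
  "quad_form A (weighted_laplacian E w) x = (\<Sum>e\<in>E. w e * (\<Sum>l\<in>A. incidence e l * x l)\<^sup>2)"
proof -
  have "quad_form A (weighted_laplacian E w) x
      = (\<Sum>r\<in>A. \<Sum>c\<in>A. \<Sum>e\<in>E. w e * ((incidence e r * x r) * (incidence e c * x c)))"
    unfolding quad_form_def weighted_laplacian_def sum_distrib_left sum_distrib_right
    by (intro sum.cong refl) simp
  also have "\<dots> = (\<Sum>r\<in>A. \<Sum>e\<in>E. \<Sum>c\<in>A. w e * ((incidence e r * x r) * (incidence e c * x c)))"
    by (intro sum.cong refl sum.swap)
  also have "\<dots> = (\<Sum>e\<in>E. \<Sum>r\<in>A. \<Sum>c\<in>A. w e * ((incidence e r * x r) * (incidence e c * x c)))"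
    by (rule sum.swap)
  also have "\<dots> = (\<Sum>e\<in>E. w e * (\<Sum>l\<in>A. incidence e l * x l)\<^sup>2)"
    unfolding power2_eq_square sum_product by (simp only: sum_distrib_left)
  finally show ?thesis .
qed

section \<open>The constraint sets\<close>

text \<open>Off the patch the value is the fixed baseline, which is reproduced exactly because the
  weights sum to 1.\<close>

lemma affine_map_assembled: "affine_map (assembled M \<Omega>)"
  unfolding affine_map_def
proof (intro allI impI ext)
  fix u v and a b :: real and p
  assume "a + b = 1"
  then have "baseline M p = a * baseline M p + b * baseline M p"
    by (simp flip: distrib_right)
  then show "assembled M \<Omega> (a *\<^sub>R u + b *\<^sub>R v) p
      = (a *\<^sub>R assembled M \<Omega> u + b *\<^sub>R assembled M \<Omega> v) p"
    by (simp add: assembled_def scaleR_fun_def)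
qed

lemma convex_vectors_on: "convex (vectors_on A)"
  by (auto simp: convex_def vectors_on_def scaleR_fun_def)

lemma convex_C_glob: "convex (C_glob M)"
proof (rule convexI)
  fix u v and a b :: real
  assume uv: "u \<in> C_glob M" "v \<in> C_glob M" and ab: "0 \<le> a" "0 \<le> b" "a + b = 1"
  let ?w = "a *\<^sub>R u + b *\<^sub>R v"
  \<comment> \<open>Reduces each homogeneous constraint to linearity of the functional whose sign it
    prescribes.\<close>
  have pos: "0 \<le> f ?w" if "linear f" "0 \<le> f u" "0 \<le> f v" for f :: "(node \<Rightarrow> real) \<Rightarrow> real"
    using that ab by (simp add: linear_add linear_scale)
  have w: "?w p = a * u p + b * v p" for p
    by (simp add: scaleR_fun_def)
  have "?w \<in> vectors_on (grid M)"
    using uv ab convex_vectors_on[of "grid M"] by (simp add: C_glob_def convex_def)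
  \<comment> \<open>The upper bound is not homogeneous: here an average of two numbers below
    \<open>forward M p\<close> stays below it.\<close>
  moreover have "0 \<le> ?w p \<and> ?w p \<le> forward M p" if "p \<in> grid M" for p
    using uv that ab unfolding w C_glob_def
    by (auto intro!: convex_bound_le)
  \<comment> \<open>The difference is negated so that monotonicity becomes a nonnegativity condition
    for \<open>pos\<close>.\<close>
  moreover have "?w (i + 1, j) - ?w (i, j) \<le> 0"
    if "i \<in> {1..<n_m M}" "j \<in> {1..n_tau M}" for i j
    using uv that pos[of "\<lambda>u. u (i, j) - u (i + 1, j)"]
    by (simp add: C_glob_def linear_compose_sub linear_apply)
  moreover have "?w (i + 1, j) - 2 * ?w (i, j) + ?w (i - 1, j) \<ge> 0"
    if "i \<in> {2..<n_m M}" "j \<in> {1..n_tau M}" for i j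
  proof (rule pos)
    show "linear (\<lambda>u :: node \<Rightarrow> real. u (i + 1, j) - 2 * u (i, j) + u (i - 1, j))"
      by (intro linearI) (simp_all add: scaleR_fun_def algebra_simps)
  qed (use uv that in \<open>simp_all add: C_glob_def\<close>)
  moreover have "mat_vec (grid M) (calendar M) ?w g \<ge> 0" if "g \<in> grid M" for g
  proof (rule pos)
    show "linear (\<lambda>u. mat_vec (grid M) (calendar M) u g)"
      using linear_compose[OF linear_mat_vec linear_apply] by (simp add: o_def)
  qed (use uv that in \<open>simp_all add: C_glob_def\<close>)
  ultimately show "?w \<in> C_glob M"
    unfolding C_glob_def by blast
qed

lemma convex_C_u: "convex (C_u M \<Omega>)"
proof -
  have "C_u M \<Omega> = vectors_on \<Omega> \<inter> assembled M \<Omega> -` C_glob M"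
    by (auto simp: C_u_def)
  then show ?thesis
    by (simp add: convex_Int convex_vectors_on convex_affine_vimage affine_map_assembled
        convex_C_glob)
qed

lemma convex_C_pi: "convex (C_pi M \<Omega>)"
proof (rule convexI)
  fix u v and a b :: real
  assume uv: "u \<in> C_pi M \<Omega>" "v \<in> C_pi M \<Omega>" and ab: "0 \<le> a" "0 \<le> b" "a + b = 1"
  have "a *\<^sub>R u + b *\<^sub>R v \<in> vectors_on (lattice M \<Omega>)"
    using uv ab convex_vectors_on[of "lattice M \<Omega>"] by (simp add: C_pi_def convex_def)
  then show "a *\<^sub>R u + b *\<^sub>R v \<in> C_pi M \<Omega>"
    using uv ab
    by (simp add: C_pi_def scaleR_fun_def sum.distrib flip: sum_distrib_left)
qed

text \<open>Sites off the lattice carry the value 0, so the bound holds at every site and applies to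
  each summand of \<open>outside_mass\<close>.\<close>

lemma C_pi_nonneg: "\<pi> \<in> C_pi M \<Omega> \<Longrightarrow> 0 \<le> \<pi> l"
  by (cases "l \<in> lattice M \<Omega>") (simp_all add: C_pi_def vectors_on_def del: split_paired_All)

section \<open>The energy terms\<close>

text \<open>With s linear in the surface, the violation is the maximum of the affine functions b -
  s, 0 and s - a.\<close>

lemma convex_on_quote_violation: "convex_on UNIV (quote_violation M q)"
proof -
  have "linear (\<lambda>u. mat_vec (grid M) (interp M) u q)"
    using linear_compose[OF linear_mat_vec linear_apply] by (simp add: o_def)
  then have "affine_map (\<lambda>u. mat_vec (grid M) (interp M) u q)"
    by (rule affine_map_linear)
  then show ?thesis
    unfolding quote_violation_def Let_def
    by (intro convex_on_max)
      (simp_all add: convex_on_const convex_on_affine affine_map_diff_const affine_map_const_diff)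
qed

lemma linear_outside_mass: "linear (outside_mass M P q)"
  by (intro linearI)
    (simp_all add: outside_mass_def scaleR_fun_def sum.distrib sum_distrib_left)

lemma convex_on_quote_energy:
  assumes "0 < epsilon M" "0 \<le> lambda_noise M" "convex S" "S \<subseteq> UNIV \<times> C_pi M \<Omega>"
  shows "convex_on S (\<lambda>x. quote_energy M P q (fst x) (snd x))"
proof -
  let ?d = "\<lambda>x. quote_violation M q (assembled M (nodes P) (fst x))"
  let ?t = "\<lambda>x. epsilon M + outside_mass M P q (snd x)"
  have "affine_map (\<lambda>x :: (node \<Rightarrow> real) \<times> (site \<Rightarrow> real). assembled M (nodes P) (fst x))"
    by (intro affine_map_compose[OF affine_map_assembled] affine_map_linear linear_fst)
  then have d: "convex_on S ?d"
    using assms(3) by (intro convex_on_affine_compose[OF convex_on_quote_violation]) auto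
  have t: "affine_map ?t"
    by (intro affine_map_const_add affine_map_compose[OF affine_map_linear[OF linear_outside_mass]]
        affine_map_linear linear_snd)
  \<comment> \<open>Nonnegativity of the fog keeps the denominator at least
    \<open>epsilon M\<close>.\<close>
  have "0 < ?t x" if "x \<in> S" for x
  proof -
    have "snd x \<in> C_pi M \<Omega>"
      using that assms(4) by auto
    then have "0 \<le> outside_mass M P q (snd x)"
      unfolding outside_mass_def by (intro sum_nonneg C_pi_nonneg)
    then show ?thesis
      using assms(1) by simp
  qed
  moreover have "0 \<le> ?d x" if "x \<in> S" for x
    by (simp add: quote_violation_def Let_def)
  ultimately have "convex_on S (\<lambda>x. (?d x)\<^sup>2 / ?t x)"
    by (intro convex_on_square_over_affine d t)
  \<comment> \<open>The noise penalty is a nonnegative multiple of the same affine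
    denominator.\<close>
  moreover have "convex_on S (\<lambda>x. lambda_noise M * ?t x)"
    using assms(2,3) t by (intro convex_on_cmul convex_on_affine)
  ultimately show ?thesis
    unfolding quote_energy_def by (rule convex_on_add)
qed

lemma convex_on_closeness_energy:
  assumes "0 \<le> lambda_cl M"
  shows "convex_on UNIV (closeness_energy M \<Omega>)"
proof -
  \<comment> \<open>The square cancels the root in the norm, leaving a sum of one-variable convex
    functions of the coordinates.\<close>
  have "(L2_set f \<Omega>)\<^sup>2 = (\<Sum>p\<in>\<Omega>. (f p)\<^sup>2)" for f :: "node \<Rightarrow> real"
    by (simp add: L2_set_def sum_nonneg)
  then have "closeness_energy M \<Omega>
      = (\<lambda>u. lambda_cl M / 2 * (\<Sum>p\<in>\<Omega>. (u p - restricted_baseline M \<Omega> p)\<^sup>2))"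
    by (simp add: closeness_energy_def fun_eq_iff)
  moreover have "convex_on UNIV (\<lambda>u :: node \<Rightarrow> real. (u p - c)\<^sup>2)" for p c
    by (intro convex_on_affine_compose[OF convex_power2] affine_map_diff_const affine_map_linear
        linear_apply) auto
  ultimately show ?thesis
    using assms by (auto intro!: convex_on_cmul convex_on_sum_fun)
qed

lemma convex_on_surface_energy:
  assumes "sym_psd_on (density_rows M (nodes P)) (H_rho P)"
  shows "convex_on UNIV (surface_energy M P)"
proof -
  have "affine_map (patch_density M (nodes P))"
    unfolding patch_density_def
    by (intro affine_map_compose[OF affine_map_linear[OF linear_mat_vec]] affine_map_assembled)
  then have "convex_on UNIV
      (\<lambda>u. quad_form (density_rows M (nodes P)) (H_rho P) (patch_density M (nodes P) u))"
    using assms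
    by (intro convex_on_affine_compose[OF convex_on_quad_form]) (auto simp: sym_psd_on_def)
  then show ?thesis
    unfolding surface_energy_def by (intro convex_on_cmul) auto
qed

lemma finite_lattice:
  assumes "finite \<Omega>"
  shows "finite (lattice M \<Omega>)"
proof (rule finite_subset)
  \<comment> \<open>Sites are right-nested triples while nodes are pairs, so the product has to be
    reassociated.\<close>
  show "lattice M \<Omega> \<subseteq> (\<lambda>((i, j), k). (i, j, k)) ` (\<Omega> \<times> {1..n_u M})"
    by (force simp: lattice_def)
qed (use assms in simp)

text \<open>The form splits into three nonnegatively weighted Laplacian forms and a diagonal form
  with nonnegative potential.\<close>

lemma quad_form_H_pi_nonneg:
  assumes "valid_model M" "valid_patch M P"
  shows "0 \<le> quad_form (lattice M (nodes P)) (H_pi M P) x"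
proof -
  have "finite (nodes P)"
    using assms(2) by (auto simp: valid_patch_def grid_def intro: finite_subset)
  then have fin: "finite (lattice M (nodes P))"
    by (rule finite_lattice)
  have laplacian: "0 \<le> quad_form A (weighted_laplacian E w) x"
    if "\<forall>e\<in>E. 0 \<le> w e" for A E w
    using that by (auto simp: quad_form_weighted_laplacian intro!: sum_nonneg)
  have "0 \<le> potential M P l" for l
    using assms(1) by (simp add: potential_nonneg valid_model_def)
  then show ?thesis
    using assms unfolding H_pi_def[abs_def] L_pi_def quad_form_add quad_form_cmul
      quad_form_diagonal[OF fin]
    by (auto simp: valid_model_def valid_patch_def
        intro!: add_nonneg_nonneg mult_nonneg_nonneg laplacian sum_nonneg)
qed

lemma convex_on_hamiltonian_energy:
  assumes "valid_model M" "valid_patch M P"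
  shows "convex_on UNIV (hamiltonian_energy M P)"
  unfolding hamiltonian_energy_def
  by (intro convex_on_cmul convex_on_quad_form quad_form_H_pi_nonneg assms) simp

theorem proposition19:
  fixes M :: fog_model and P :: fog_patch
  assumes "valid_model M"
    and "valid_patch M P"
    and "feasible M (nodes P)"
  shows "convex_on (C_u M (nodes P) \<times> C_pi M (nodes P)) (\<lambda>(u\<^sub>I, \<pi>). patch_energy M P u\<^sub>I \<pi>)"
proof -
  let ?S = "C_u M (nodes P) \<times> C_pi M (nodes P)"
  have S: "convex ?S"
    by (intro convex_Times convex_C_u convex_C_pi)
  \<comment> \<open>Terms in one variable are lifted to the product by composing with a linear
    projection.\<close>
  have fst: "convex_on ?S (\<lambda>x. f (fst x))" if "convex_on UNIV f" for f :: "(node \<Rightarrow> real) \<Rightarrow> real"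
    using S by (intro convex_on_affine_compose[OF that] affine_map_linear linear_fst) auto
  have snd: "convex_on ?S (\<lambda>x. f (snd x))" if "convex_on UNIV f" for f :: "(site \<Rightarrow> real) \<Rightarrow> real"
    using S by (intro convex_on_affine_compose[OF that] affine_map_linear linear_snd) auto
  have "convex_on ?S (\<lambda>x. quote_energy M P q (fst x) (snd x))" for q
    using assms(1) S by (intro convex_on_quote_energy) (auto simp: valid_model_def)
  moreover have "convex_on ?S (\<lambda>x. closeness_energy M (nodes P) (fst x))"
    using assms(1) by (intro fst convex_on_closeness_energy) (simp add: valid_model_def)
  moreover have "convex_on ?S (\<lambda>x. surface_energy M P (fst x))"
    using assms(2) by (intro fst convex_on_surface_energy) (simp add: valid_patch_def)
  moreover have "convex_on ?S (\<lambda>x. hamiltonian_energy M P (snd x))"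
    using assms(1,2) by (intro snd convex_on_hamiltonian_energy)
  ultimately show ?thesis
    unfolding patch_energy_def case_prod_beta using assms(1) S
    by (intro convex_on_add convex_on_cmul convex_on_sum_fun) (auto simp: valid_model_def)
qed

end
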